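(* Let $R$ be an integral domain with unity, let $\mathbb{F}$ be a field with $\mathrm{char}(\mathbb{F})=0$ containing $R$ as a subring, let $n\in\mathbb{N}$ with $n\geq 1$, and let $A\colon R\to R\subset\mathbb{F}$ be an additive mapping satisfying $A(1)=0$. Then $A\in\mathscr{D}_{n}(R)$ if and only if there exist constants $a_{1},\ldots,a_{n+1}\in\mathbb{F}$, not all zero, such that $$\sum_{i=0}^{n}a_{n+1-i}\,x^{i}A\left(x^{n+1-i}\right)=0$$ for any $x\in R$. Moreover, if $A$ is a not identically zero solution of this equation (with constants $a_1,\ldots,a_{n+1}$), then $\sum_{i=1}^{n+1}i\,a_{i}=0$.
   Context: A mapping $f\colon R\to R$ on a ring is additive if $f(x+y)=f(x)+f(y)$ for all $x,y\in R$. Higher order derivations: let $R$ be a ring. The identically zero map is the only derivation of order zero. For each integer $n\ge 1$, an additive mapping $f\colon R\to R$ is a derivation of order $n$ if there exists $B\colon R\times R\to R$ such that $B$ is a bi-derivation of order $n-1$ (that is, $B$ is a derivation of order $n-1$ in each variable, the other variable being fixed) and $f(xy)-xf(y)-f(x)y=B(x,y)$ for all $x,y\in R$. The set of derivations of order $n$ of $R$ is denoted by $\mathscr{D}_{n}(R)$. The equation is understood in $\mathbb{F}$, with $x^0=1$ for all $x\in R$. *)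

theory Defs
  imports Complex_Main "HOL-Library.FuncSet"
begin

text \<open>
  The ring \<open>R\<close> is a carrier set inside the type of the ambient field. A map \<open>R \<rightarrow> R\<close> is
  represented by a function on the whole type, of which only the restriction to \<open>R\<close> matters:
  all conditions below are relativised to \<open>R\<close>.
\<close>

text \<open>
  Unital subrings; zero and negatives are obtained from \<open>1 - 1\<close> and \<open>0 - x\<close>. In a field
  every such \<open>R\<close> is an integral domain, and every subring which is an integral domain with
  its own unity has this form, because the only nonzero idempotent of a field is 1.
\<close>

definition subring_of :: "'a::ring_1 set \<Rightarrow> bool" where
  "subring_of R \<longleftrightarrow> 1 \<in> R \<and> (\<forall>x\<in>R. \<forall>y\<in>R. x - y \<in> R \<and> x * y \<in> R)"

definition additive_map :: "'a::ring set \<Rightarrow> ('a \<Rightarrow> 'a) \<Rightarrow> bool" where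
  "additive_map R f \<longleftrightarrow> f \<in> R \<rightarrow> R \<and> (\<forall>x\<in>R. \<forall>y\<in>R. f (x + y) = f x + f y)"

primrec derivations :: "nat \<Rightarrow> 'a::ring set \<Rightarrow> ('a \<Rightarrow> 'a) set" where
  "derivations 0 R = {f. \<forall>x\<in>R. f x = 0}"
| "derivations (Suc n) R =
     {f. additive_map R f \<and>
         (\<exists>B :: 'a \<Rightarrow> 'a \<Rightarrow> 'a.
            (\<forall>y\<in>R. (\<lambda>x. B x y) \<in> derivations n R) \<and>
            (\<forall>x\<in>R. (\<lambda>y. B x y) \<in> derivations n R) \<and>
            (\<forall>x\<in>R. \<forall>y\<in>R. f (x * y) - x * f y - f x * y = B x y))}"

end

theory Submission
  imports Defs "HOL-Computational_Algebra.Polynomial"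
begin

text \<open>
  Let \<open>ad x f\<close> be the commutator of \<open>f\<close> with the multiplication by \<open>x\<close>, and
  \<open>d\<^sub>i x = ad x (\<dots> (ad x A)) 1\<close> with \<open>i\<close> commutators. The binomial theorem gives
  \<open>A (x ^ j) = (\<Sum>i\<le>j. (j choose i) * x ^ (j - i) * d\<^sub>i x)\<close>, so the equation reads
  \<open>(\<Sum>i\<le>N. b\<^sub>i * x ^ (N - i) * d\<^sub>i x) = 0\<close> with \<open>N = n + 1\<close> and
  \<open>b\<^sub>i = (\<Sum>j. (j choose i) * a\<^sub>j)\<close>. Since \<open>d\<^sub>i\<close> is invariant under \<open>x \<mapsto> x + k\<close> for natural \<open>k\<close>,
  the left side is a polynomial in \<open>k\<close>, whence \<open>b\<^sub>i * d\<^sub>i x = 0\<close> for every \<open>i\<close>.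
  The largest \<open>m\<close> with \<open>a\<^sub>m \<noteq> 0\<close> has \<open>b\<^sub>m = a\<^sub>m\<close>, so \<open>d\<^sub>m = 0\<close>; by polarisation this means that \<open>A\<close>
  is a derivation of order \<open>m - 1\<close>. The second claim is the case \<open>i = 1\<close>, as \<open>d\<^sub>1 = A\<close>.
  Conversely, \<open>d\<^bsub>n+1\<^esub> = 0\<close> for a derivation of order \<open>n\<close>, and this is an equation of the required
  form with binomial coefficients.
\<close>

section \<open>Iterated commutators and their binomial expansions\<close>

definition ad :: "'a::comm_ring_1 \<Rightarrow> ('a \<Rightarrow> 'a) \<Rightarrow> 'a \<Rightarrow> 'a" where
  "ad x f = (\<lambda>y. f (x * y) - x * f y)"

lemma ad_commute: "ad x (ad y f) = ad y (ad x f)"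
  by (simp add: ad_def fun_eq_iff algebra_simps)

lemma funpow_ad_linear:
  "(ad x ^^ m) (\<lambda>y. f y + c * g y) = (\<lambda>y. (ad x ^^ m) f y + c * (ad x ^^ m) g y)"
  by (induction m) (simp_all add: ad_def fun_eq_iff algebra_simps)

lemma funpow_ad_zero: "(ad x ^^ m) (\<lambda>_. 0) = (\<lambda>_. 0)"
  by (induction m) (simp_all add: ad_def)

lemma funpow_ad_id: "(ad x ^^ Suc m) (\<lambda>y. y) = (\<lambda>_. 0)"
proof -
  have "ad x (\<lambda>y. y) = (\<lambda>_. 0)"
    by (simp add: ad_def)
  then show ?thesis
    by (simp add: funpow_Suc_right funpow_ad_zero del: funpow.simps)
qed

text \<open>Multiplications commute with each other, so a first commutator already kills
  \<open>c * y\<close>. This lets one pass between \<open>ad x f\<close> and the defect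
  \<open>B x\<close>, which differ by multiplication by \<open>f x\<close>.\<close>

lemma funpow_ad_add_smult_id:
  "(ad x ^^ Suc m) (\<lambda>y. f y + c * y) = (ad x ^^ Suc m) f"
  by (simp only: funpow_ad_linear[where g = "\<lambda>y. y"] funpow_ad_id) simp

text \<open>Pascal's rule, in the shape of the induction step of both expansions below.\<close>

lemma sum_binomial_Suc:
  fixes h :: "nat \<Rightarrow> 'a::comm_ring_1"
  shows "(\<Sum>i\<le>Suc m. of_nat (Suc m choose i) * h i) =
    (\<Sum>i\<le>m. of_nat (m choose i) * h i) + (\<Sum>i\<le>m. of_nat (m choose i) * h (Suc i))"
proof -
  have "(\<Sum>i\<le>Suc m. of_nat (Suc m choose i) * h i) =
      h 0 + (\<Sum>i\<le>m. of_nat (Suc m choose Suc i) * h (Suc i))"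
    by (simp only: sum.atMost_Suc_shift) simp
  also have "\<dots> = (h 0 + (\<Sum>i\<le>m. of_nat (m choose Suc i) * h (Suc i)))
      + (\<Sum>i\<le>m. of_nat (m choose i) * h (Suc i))"
    by (simp add: sum.distrib algebra_simps)
  also have "h 0 + (\<Sum>i\<le>m. of_nat (m choose Suc i) * h (Suc i)) =
      (\<Sum>i\<le>Suc m. of_nat (m choose i) * h i)"
    by (simp only: sum.atMost_Suc_shift) simp
  also have "\<dots> = (\<Sum>i\<le>m. of_nat (m choose i) * h i)"
    by (simp add: binomial_eq_0)
  finally show ?thesis .
qed

text \<open>Precomposing with multiplication by \<open>x\<close> is the sum of two commuting
  operators, postcomposing with it and \<open>ad x\<close>; its \<open>j\<close>-th power is
  expanded.\<close>

lemma power_mult_binomial_ad: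
  "f (x ^ j * y) = (\<Sum>i\<le>j. of_nat (j choose i) * (x ^ (j - i) * (ad x ^^ i) f y))"
proof (induction j arbitrary: f)
  case 0
  show ?case by simp
next
  case (Suc j)
  have "f (x ^ Suc j * y) = x * f (x ^ j * y) + ad x f (x ^ j * y)"
    by (simp add: ad_def mult.assoc)
  also have "\<dots> = (\<Sum>i\<le>j. of_nat (j choose i) * (x ^ (Suc j - i) * (ad x ^^ i) f y)) +
      (\<Sum>i\<le>j. of_nat (j choose i) * (x ^ (Suc j - Suc i) * (ad x ^^ Suc i) f y))"
    \<comment> \<open>The hypothesis is used for \<open>f\<close> and for \<open>ad x f\<close>,
      hence the generalisation over \<open>f\<close>.\<close>
    unfolding Suc[of f] Suc[of "ad x f"]
    by (simp add: funpow_swap1 sum_distrib_left Suc_diff_le mult_ac cong: sum.cong_simp)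
  also have "\<dots> = (\<Sum>i\<le>Suc j. of_nat (Suc j choose i) * (x ^ (Suc j - i) * (ad x ^^ i) f y))"
    by (rule sum_binomial_Suc[symmetric])
  finally show ?case .
qed

text \<open>The inverse expansion: \<open>ad x\<close> is the difference of the same two commuting
  operators.\<close>

lemma funpow_ad_binomial:
  "(ad x ^^ m) f y = (\<Sum>j\<le>m. of_nat (m choose j) * ((- x) ^ (m - j) * f (x ^ j * y)))"
proof (induction m arbitrary: y)
  case 0
  show ?case by simp
next
  case (Suc m)
  have "(ad x ^^ Suc m) f y = - x * (ad x ^^ m) f y + (ad x ^^ m) f (x * y)"
    by (simp add: ad_def)
  also have "\<dots> = (\<Sum>j\<le>m. of_nat (m choose j) * ((- x) ^ (Suc m - j) * f (x ^ j * y))) +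
      (\<Sum>j\<le>m. of_nat (m choose j) * ((- x) ^ (Suc m - Suc j) * f (x ^ Suc j * y)))"
    unfolding Suc[of y] Suc[of "x * y"]
    by (simp add: sum_distrib_left Suc_diff_le mult_ac cong: sum.cong_simp)
  also have "\<dots> = (\<Sum>j\<le>Suc m. of_nat (Suc m choose j) * ((- x) ^ (Suc m - j) * f (x ^ j * y)))"
    by (rule sum_binomial_Suc[symmetric])
  finally show ?case .
qed

section \<open>Polynomials vanishing at all natural numbers\<close>

lemma poly_of_nat_zeros_imp_zero:
  fixes p :: "'a::{idom,ring_char_0} poly"
  assumes "\<And>k. poly p (of_nat k) = 0"
  shows "p = 0"
proof (rule ccontr)
  assume "p \<noteq> 0"
  then have "finite {x. poly p x = 0}"
    by (rule poly_roots_finite)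
  moreover have "range (of_nat :: nat \<Rightarrow> 'a) \<subseteq> {x. poly p x = 0}"
    using assms by auto
  ultimately have "finite (range (of_nat :: nat \<Rightarrow> 'a))"
    by (rule rev_finite_subset)
  then show False
    using finite_imageD[OF _ inj_of_nat] infinite_UNIV_nat by blast
qed

lemma sum_powers_zero_imp_coeffs_zero:
  fixes c :: "nat \<Rightarrow> 'a::{idom,ring_char_0}"
  assumes "\<And>k. (\<Sum>i\<le>N. c i * (x + of_nat k) ^ (N - i)) = 0" and "i \<le> N"
  shows "c i = 0"
proof -
  define p where "p = (\<Sum>i\<le>N. monom (c i) (N - i))"
  \<comment> \<open>Composing with \<open>[:x, 1:]\<close> moves the zeros \<open>x + k\<close> to
    \<open>k\<close>; composition with a nonconstant polynomial has trivial kernel.\<close>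
  have "poly (p \<circ>\<^sub>p [:x, 1:]) (of_nat k) = 0" for k
    using assms(1)[of k] by (simp add: p_def poly_pcompose poly_sum poly_monom)
  then have "p \<circ>\<^sub>p [:x, 1:] = 0"
    by (rule poly_of_nat_zeros_imp_zero)
  then have "p = 0"
    by (rule pcompose_eq_0) simp
  then have "0 = coeff p (N - i)"
    by simp
  also have "\<dots> = (\<Sum>j\<le>N. if j = i then c j else 0)"
    unfolding p_def coeff_sum using assms(2) by (intro sum.cong) auto
  finally show ?thesis
    using assms(2) by simp
qed

lemma derivations_subset_Suc: "derivations n R \<subseteq> derivations (Suc n) R"
  if "\<And>x y. x \<in> R \<Longrightarrow> y \<in> R \<Longrightarrow> x * y \<in> R" "\<And>x y. x \<in> R \<Longrightarrow> y \<in> R \<Longrightarrow> x + y \<in> R" "0 \<in> R"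
proof (induction n)
  case 0
  show ?case
    using that by (auto simp: additive_map_def intro!: exI[of _ "\<lambda>_ _. 0"])
next
  case (Suc n)
  show ?case
  proof
    fix f assume "f \<in> derivations (Suc n) R"
    then obtain B where "additive_map R f" "\<forall>y\<in>R. (\<lambda>x. B x y) \<in> derivations n R"
      "\<forall>x\<in>R. (\<lambda>y. B x y) \<in> derivations n R" "\<forall>x\<in>R. \<forall>y\<in>R. f (x * y) - x * f y - f x * y = B x y"
      by auto
    with Suc show "f \<in> derivations (Suc (Suc n)) R"
      unfolding derivations.simps(2)[of "Suc n"] by blast
  qed
qed

section \<open>Commutators of additive maps on a subring\<close>

context
  fixes R :: "'a::comm_ring_1 set"
  assumes R: "subring_of R"
begin

lemma subring_closed:
  shows "1 \<in> R" and "0 \<in> R" and "x \<in> R \<Longrightarrow> y \<in> R \<Longrightarrow> x * y \<in> R"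
    and "x \<in> R \<Longrightarrow> y \<in> R \<Longrightarrow> x - y \<in> R" and "x \<in> R \<Longrightarrow> y \<in> R \<Longrightarrow> x + y \<in> R"
    and "of_nat k \<in> R"
proof -
  show one: "1 \<in> R" and "x \<in> R \<Longrightarrow> y \<in> R \<Longrightarrow> x * y \<in> R"
    and diff: "x \<in> R \<Longrightarrow> y \<in> R \<Longrightarrow> x - y \<in> R" for x y
    using R by (auto simp: subring_of_def)
  from diff[OF one one] show zero: "0 \<in> R"
    by simp
  show add: "x \<in> R \<Longrightarrow> y \<in> R \<Longrightarrow> x + y \<in> R" for x y
    using diff[of x "0 - y"] diff[OF zero] by simp
  show "of_nat k \<in> R"
    by (induction k) (simp_all add: zero one add)
qed

text \<open>At points of \<open>R\<close> only values of the map on \<open>R\<close> enter.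
  Identities derived from additivity hold only there, so they are inserted under iterated
  commutators through this rule.\<close>

lemma funpow_ad_cong:
  assumes "\<And>y. y \<in> R \<Longrightarrow> f y = g y" "x \<in> R" "y \<in> R"
  shows "(ad x ^^ m) f y = (ad x ^^ m) g y"
  using assms(3)
  by (induction m arbitrary: y) (simp_all add: assms ad_def subring_closed)

lemma derivations_le_mono: "m \<le> n \<Longrightarrow> derivations m R \<subseteq> derivations n R"
  by (rule lift_Suc_mono_le[of "\<lambda>n. derivations n R"])
    (simp_all only: derivations_subset_Suc subring_closed)

lemma additive_map_of_nat_mult:
  assumes f: "additive_map R f" and x: "x \<in> R"
  shows "f (of_nat k * x) = of_nat k * f x"
proof (induction k)
  case 0
  have "f (0 + 0) = f 0 + f 0"
    using f subring_closed(2) unfolding additive_map_def by blast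
  then show ?case by simp
next
  case (Suc k)
  have "f (of_nat k * x + x) = f (of_nat k * x) + f x"
    using f x subring_closed(3)[OF subring_closed(6) x] unfolding additive_map_def by blast
  moreover have "of_nat (Suc k) * x = of_nat k * x + x"
    by (simp add: algebra_simps)
  ultimately show ?case
    by (simp only: Suc) (simp add: algebra_simps)
qed

lemma additive_map_ad: "additive_map R f \<Longrightarrow> x \<in> R \<Longrightarrow> additive_map R (ad x f)"
  by (auto simp: additive_map_def ad_def Pi_iff subring_closed algebra_simps)

lemma additive_map_add_smult:
  "additive_map R f \<Longrightarrow> c \<in> R \<Longrightarrow> additive_map R (\<lambda>y. f y + c * y)"
  by (auto simp: additive_map_def Pi_iff subring_closed algebra_simps)

lemma ad_add_of_nat_mult:
  assumes f: "additive_map R f" and "x \<in> R" "y \<in> R" "z \<in> R"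
  shows "ad (x + of_nat k * y) f z = ad x f z + of_nat k * ad y f z"
proof -
  have "f (x * z + of_nat k * (y * z)) = f (x * z) + f (of_nat k * (y * z))"
    using assms by (simp add: additive_map_def subring_closed)
  also have "f (of_nat k * (y * z)) = of_nat k * f (y * z)"
    using assms by (simp add: additive_map_of_nat_mult subring_closed)
  finally show ?thesis
    by (simp add: ad_def algebra_simps)
qed

text \<open>The case \<open>y = 1\<close> of the preceding lemma, where \<open>ad 1 f\<close>
  vanishes.\<close>

lemma ad_add_of_nat:
  assumes f: "additive_map R f" and "x \<in> R" "z \<in> R"
  shows "ad (x + of_nat k) f z = ad x f z"
  using ad_add_of_nat_mult[OF f \<open>x \<in> R\<close> subring_closed(1) \<open>z \<in> R\<close>, of k]
  by (simp add: ad_def)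

lemma funpow_ad_add_of_nat:
  assumes "additive_map R f" "x \<in> R" "z \<in> R"
  shows "(ad (x + of_nat k) ^^ m) f z = (ad x ^^ m) f z"
  using assms(1)
proof (induction m arbitrary: f)
  case 0
  show ?case by simp
next
  case (Suc m)
  have "(ad (x + of_nat k) ^^ m) (ad (x + of_nat k) f) z = (ad (x + of_nat k) ^^ m) (ad x f) z"
    using Suc.prems assms by (intro funpow_ad_cong) (simp_all add: ad_add_of_nat subring_closed)
  also have "\<dots> = (ad x ^^ m) (ad x f) z"
    using Suc.prems assms by (simp add: Suc.IH additive_map_ad)
  finally show ?case
    by (simp add: funpow_Suc_right del: funpow.simps)
qed

text \<open>The coefficient of \<open>k\<close> is what polarisation extracts.\<close>

lemma funpow_ad_add_of_nat_mult_poly: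
  assumes "additive_map R f" "x \<in> R" "y \<in> R" "z \<in> R"
  shows "\<exists>p. (\<forall>k. (ad (x + of_nat k * y) ^^ m) f z = poly p (of_nat k)) \<and>
    coeff p 0 = (ad x ^^ m) f z \<and> coeff p 1 = of_nat m * (ad x ^^ (m - 1)) (ad y f) z"
  using assms(1)
proof (induction m arbitrary: f)
  case 0
  show ?case
    by (intro exI[of _ "[:f z:]"]) simp
next
  case (Suc m)
  have add: "additive_map R (ad x f)" "additive_map R (ad y f)"
    using Suc.prems assms by (simp_all add: additive_map_ad)
  from Suc.IH[OF add(1)] Suc.IH[OF add(2)] obtain p q where
    p: "\<And>k. (ad (x + of_nat k * y) ^^ m) (ad x f) z = poly p (of_nat k)"
      "coeff p 0 = (ad x ^^ m) (ad x f) z"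
      "coeff p 1 = of_nat m * (ad x ^^ (m - 1)) (ad y (ad x f)) z" and
    q: "\<And>k. (ad (x + of_nat k * y) ^^ m) (ad y f) z = poly q (of_nat k)"
      "coeff q 0 = (ad x ^^ m) (ad y f) z"
    by auto
  \<comment> \<open>The innermost commutator splits as \<open>ad x f + k * ad y f\<close>; the
    factor \<open>k\<close> turns \<open>q\<close> into \<open>pCons 0 q\<close>.\<close>
  have "(ad (x + of_nat k * y) ^^ Suc m) f z = poly (p + pCons 0 q) (of_nat k)" for k
  proof -
    let ?w = "x + of_nat k * y"
    have "(ad ?w ^^ m) (ad ?w f) z = (ad ?w ^^ m) (\<lambda>u. ad x f u + of_nat k * ad y f u) z"
      using Suc.prems assms
      by (intro funpow_ad_cong) (simp_all add: ad_add_of_nat_mult subring_closed)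
    then show ?thesis
      by (simp add: funpow_ad_linear p q funpow_Suc_right del: funpow.simps)
  qed
  moreover have "coeff (p + pCons 0 q) 0 = (ad x ^^ Suc m) f z"
    by (simp add: p funpow_Suc_right del: funpow.simps)
  moreover have "coeff (p + pCons 0 q) 1 = of_nat (Suc m) * (ad x ^^ (Suc m - 1)) (ad y f) z"
  proof -
    \<comment> \<open>Commutators commute, so \<open>ad y\<close> can be moved inside. For
      \<open>m = 0\<close> the factor \<open>of_nat m\<close> absorbs the truncated
      \<open>m - 1\<close>.\<close>
    have "of_nat m * (ad x ^^ (m - 1)) (ad y (ad x f)) z = of_nat m * (ad x ^^ m) (ad y f) z"
      by (cases m) (simp_all add: ad_commute[of y] funpow_Suc_right del: funpow.simps)
    then show ?thesis
      using p(3) q(2) by (simp add: algebra_simps)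
  qed
  ultimately show ?case
    by blast
qed

section \<open>Order of a derivation and vanishing of commutators\<close>

text \<open>On \<open>R\<close>, \<open>ad x f\<close> is \<open>B x\<close> plus multiplication by
  \<open>f x\<close>. The latter is invisible to further commutators, and \<open>B x\<close> has
  order one less.\<close>

lemma derivations_imp_funpow_ad_zero:
  assumes "f \<in> derivations n R" "x \<in> R"
  shows "(ad x ^^ Suc n) f 1 = 0"
  using assms(1)
proof (induction n arbitrary: f)
  case 0
  then show ?case
    using assms(2) by (simp add: ad_def subring_closed)
next
  case (Suc n)
  then obtain B where B: "(\<lambda>y. B x y) \<in> derivations n R"
    "\<And>y. y \<in> R \<Longrightarrow> f (x * y) - x * f y - f x * y = B x y"
    using assms(2) by auto
  have "(ad x ^^ Suc n) (ad x f) 1 = (ad x ^^ Suc n) (\<lambda>y. B x y + f x * y) 1"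
    using assms(2) B(2) by (intro funpow_ad_cong) (auto simp: ad_def subring_closed algebra_simps)
  also have "\<dots> = (ad x ^^ Suc n) (\<lambda>y. B x y) 1"
    by (simp only: funpow_ad_add_smult_id)
  also have "\<dots> = 0"
    by (rule Suc.IH) (rule B(1))
  finally show ?case
    by (simp add: funpow_Suc_right del: funpow.simps)
qed

end

text \<open>Replacing \<open>x\<close> by \<open>x + k * y\<close> gives a polynomial in
  \<open>k\<close> with all natural numbers as zeros. Its linear coefficient is \<open>m + 1\<close>
  times the mixed commutator, and \<open>m + 1\<close> is cancelled in characteristic 0.\<close>

lemma polarised_funpow_ad_zero:
  fixes R :: "'a::{idom,ring_char_0} set"
  assumes R: "subring_of R" and f: "additive_map R f"
    and zero: "\<And>x. x \<in> R \<Longrightarrow> (ad x ^^ Suc m) f 1 = 0" and x: "x \<in> R" and y: "y \<in> R"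
  shows "(ad x ^^ m) (ad y f) 1 = 0"
proof -
  obtain p where p: "\<And>k. (ad (x + of_nat k * y) ^^ Suc m) f 1 = poly p (of_nat k)"
    "coeff p 1 = of_nat (Suc m) * (ad x ^^ m) (ad y f) 1"
    using funpow_ad_add_of_nat_mult_poly[OF R f x y subring_closed(1)[OF R], of "Suc m"] by auto
  have "poly p (of_nat k) = 0" for k
    using zero[of "x + of_nat k * y"] x y p(1)[of k] by (simp add: subring_closed[OF R])
  then have "p = 0"
    by (rule poly_of_nat_zeros_imp_zero)
  with p(2) have "of_nat (Suc m) * (ad x ^^ m) (ad y f) 1 = 0"
    by simp
  then show ?thesis
    by (simp del: of_nat_Suc)
qed

text \<open>Induction on the order: polarisation passes the vanishing condition from
  \<open>f\<close> to each \<open>B x\<close>, with one commutator fewer.\<close>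

lemma funpow_ad_zero_imp_derivations:
  fixes R :: "'a::{idom,ring_char_0} set"
  assumes R: "subring_of R" and "additive_map R f" "f 1 = 0"
    and "\<And>x. x \<in> R \<Longrightarrow> (ad x ^^ Suc m) f 1 = 0"
  shows "f \<in> derivations m R"
  using assms(2-)
proof (induction m arbitrary: f)
  case 0
  then show ?case
    by (simp add: ad_def)
next
  case (Suc m)
  define B where "B = (\<lambda>x y. ad x f y + (- f x) * y)"
  \<comment> \<open>By symmetry the order need be checked in one variable only.\<close>
  have sym: "B x y = B y x" for x y
    by (simp add: B_def ad_def algebra_simps)
  have B: "B x \<in> derivations m R" if x: "x \<in> R" for x
  proof (rule Suc.IH)
    have "- f x \<in> R"
      using Suc.prems(1) x subring_closed(4)[OF R subring_closed(2)[OF R], of "f x"]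
      by (auto simp: additive_map_def)
    then show "additive_map R (B x)"
      unfolding B_def using R Suc.prems(1) x
      by (intro additive_map_add_smult additive_map_ad)
    show "B x 1 = 0"
      using Suc.prems(2) by (simp add: B_def ad_def)
    show "(ad z ^^ Suc m) (B x) 1 = 0" if "z \<in> R" for z
      unfolding B_def funpow_ad_add_smult_id
      by (rule polarised_funpow_ad_zero[OF R Suc.prems(1) Suc.prems(3) that x])
  qed
  moreover have "(\<lambda>x. B x y) \<in> derivations m R" if "y \<in> R" for y
    using B[OF that] by (simp add: sym[of _ y])
  moreover have "f (x * y) - x * f y - f x * y = B x y" for x y
    by (simp add: B_def ad_def)
  ultimately show ?case
    using Suc.prems(1) by auto
qed

section \<open>From the equation to vanishing commutators\<close>

text \<open>Expanding each \<open>f (w ^ j)\<close> at \<open>w = x + k\<close> turns the equation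
  into a polynomial identity in \<open>w\<close>. Its coefficients do not depend on
  \<open>k\<close>, because the commutators are invariant under the shift, so each of them
  vanishes.\<close>

lemma equation_imp_funpow_ad_zero:
  fixes R :: "'a::{idom,ring_char_0} set"
  assumes R: "subring_of R" and f: "additive_map R f" "f 1 = 0"
    and eq: "\<And>x. x \<in> R \<Longrightarrow> (\<Sum>j=1..N. a j * x ^ (N - j) * f (x ^ j)) = 0"
    and x: "x \<in> R" and i: "i \<in> {1..N}"
  shows "(\<Sum>j=1..N. of_nat (j choose i) * a j) * (ad x ^^ i) f 1 = 0"
proof -
  define c where "c i = (\<Sum>j=1..N. of_nat (j choose i) * a j) * (ad x ^^ i) f 1" for i
  have "(\<Sum>i\<le>N. c i * (x + of_nat k) ^ (N - i)) = 0" for k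
  proof -
    let ?w = "x + of_nat k"
    have w: "?w \<in> R"
      using x by (simp add: subring_closed[OF R])
    have "a j * ?w ^ (N - j) * f (?w ^ j) =
        (\<Sum>i\<le>N. of_nat (j choose i) * a j * (ad x ^^ i) f 1 * ?w ^ (N - i))"
      if j: "j \<in> {1..N}" for j
    proof -
      have "a j * ?w ^ (N - j) * f (?w ^ j) =
          (\<Sum>i\<le>j. a j * ?w ^ (N - j) * (of_nat (j choose i) * (?w ^ (j - i) * (ad ?w ^^ i) f 1)))"
        using power_mult_binomial_ad[of f ?w j 1] by (simp add: sum_distrib_left)
      also have "\<dots> = (\<Sum>i\<le>j. of_nat (j choose i) * a j * (ad x ^^ i) f 1 * ?w ^ (N - i))"
      proof (rule sum.cong)
        fix i assume "i \<in> {..j}"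
        then have "?w ^ (N - i) = ?w ^ (N - j) * ?w ^ (j - i)"
          using j by (simp flip: power_add)
        moreover have "(ad ?w ^^ i) f 1 = (ad x ^^ i) f 1"
          by (rule funpow_ad_add_of_nat[OF R f(1) x subring_closed(1)[OF R]])
        ultimately show "a j * ?w ^ (N - j) * (of_nat (j choose i) * (?w ^ (j - i) * (ad ?w ^^ i) f 1))
            = of_nat (j choose i) * a j * (ad x ^^ i) f 1 * ?w ^ (N - i)"
          by (simp add: mult_ac)
      qed simp
      \<comment> \<open>The added terms have \<open>i > j\<close>, so their binomial coefficients
        vanish; a range independent of \<open>j\<close> allows the sums to be swapped.\<close>
      also have "\<dots> = (\<Sum>i\<le>N. of_nat (j choose i) * a j * (ad x ^^ i) f 1 * ?w ^ (N - i))"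
        using j by (intro sum.mono_neutral_left) (auto simp: binomial_eq_0)
      finally show ?thesis .
    qed
    then have "(\<Sum>j=1..N. a j * ?w ^ (N - j) * f (?w ^ j)) =
        (\<Sum>j=1..N. \<Sum>i\<le>N. of_nat (j choose i) * a j * (ad x ^^ i) f 1 * ?w ^ (N - i))"
      by (rule sum.cong[OF refl])
    also have "\<dots> = (\<Sum>i\<le>N. \<Sum>j=1..N. of_nat (j choose i) * a j * (ad x ^^ i) f 1 * ?w ^ (N - i))"
      by (rule sum.swap)
    also have "\<dots> = (\<Sum>i\<le>N. c i * ?w ^ (N - i))"
      by (simp add: c_def sum_distrib_right)
    finally show ?thesis
      by (simp only: eq[OF w])
  qed
  then have "c i = 0"
    by (rule sum_powers_zero_imp_coeffs_zero) (use i in simp)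
  then show ?thesis
    by (simp add: c_def)
qed

theorem corollary3:
  fixes R :: "'f::field_char_0 set" and n :: nat and A :: "'f \<Rightarrow> 'f"
  assumes "subring_of R"
    and "n \<ge> 1"
    and "additive_map R A"
    and "A 1 = 0"
  shows "(A \<in> derivations n R \<longleftrightarrow>
           (\<exists>a :: nat \<Rightarrow> 'f.
              (\<exists>i\<in>{1..n+1}. a i \<noteq> 0) \<and>
              (\<forall>x\<in>R. (\<Sum>i=0..n. a (n+1-i) * x ^ i * A (x ^ (n+1-i))) = 0)))
         \<and> (\<forall>a :: nat \<Rightarrow> 'f.
              (\<forall>x\<in>R. (\<Sum>i=0..n. a (n+1-i) * x ^ i * A (x ^ (n+1-i))) = 0) \<longrightarrow>
              (\<exists>x\<in>R. A x \<noteq> 0) \<longrightarrow>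
              (\<Sum>i=1..n+1. of_nat i * a i) = 0)"
proof -
  note R = assms(1) and A = assms(3,4)
  have reindex: "(\<Sum>i=0..n. a (n+1-i) * x ^ i * A (x ^ (n+1-i))) =
      (\<Sum>j=1..n+1. a j * x ^ (n+1-j) * A (x ^ j))" for a x
    by (rule sum.reindex_bij_witness[of _ "\<lambda>j. n+1-j" "\<lambda>i. n+1-i"]) auto
  have coeff: "(\<Sum>j=1..n+1. of_nat (j choose i) * a j) * (ad x ^^ i) A 1 = 0"
    if "\<forall>x\<in>R. (\<Sum>i=0..n. a (n+1-i) * x ^ i * A (x ^ (n+1-i))) = 0" "x \<in> R" "i \<in> {1..n+1}"
    for a x i
    using that unfolding reindex by (intro equation_imp_funpow_ad_zero[OF R A]) auto
  have "\<exists>a. (\<exists>i\<in>{1..n+1}. a i \<noteq> 0) \<and>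
      (\<forall>x\<in>R. (\<Sum>i=0..n. a (n+1-i) * x ^ i * A (x ^ (n+1-i))) = 0)"
    if "A \<in> derivations n R"
  proof (intro exI conjI ballI)
    \<comment> \<open>These are the coefficients in the expansion of
      \<open>(ad x ^^ (n + 1)) A 1\<close>.\<close>
    let ?a = "\<lambda>j. of_nat (n + 1 choose j) * (- 1) ^ (n + 1 - j) :: 'f"
    show "\<exists>i\<in>{1..n+1}. ?a i \<noteq> 0"
      by (rule bexI[of _ "n + 1"]) auto
    fix x assume x: "x \<in> R"
    \<comment> \<open>The missing term \<open>j = 0\<close> contains \<open>A 1 = 0\<close>.\<close>
    have "(\<Sum>j=1..n+1. ?a j * x ^ (n+1-j) * A (x ^ j)) =
        (\<Sum>j\<le>n+1. ?a j * x ^ (n+1-j) * A (x ^ j))"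
      using A(2) by (intro sum.mono_neutral_left) (auto simp: not_less_eq_eq)
    also have "\<dots> = (\<Sum>j\<le>n+1. of_nat (n + 1 choose j) * ((- x) ^ (n + 1 - j) * A (x ^ j * 1)))"
      by (intro sum.cong) (simp_all only: power_minus[of x] mult.assoc mult_1_right)
    also have "\<dots> = (ad x ^^ (n + 1)) A 1"
      by (rule funpow_ad_binomial[symmetric])
    also have "\<dots> = 0"
      using derivations_imp_funpow_ad_zero[OF R that x] by simp
    finally show "(\<Sum>i=0..n. ?a (n+1-i) * x ^ i * A (x ^ (n+1-i))) = 0"
      by (rule trans[OF reindex[of ?a]])
  qed
  moreover have "A \<in> derivations n R"
    if nz: "\<exists>i\<in>{1..n+1}. a i \<noteq> 0"
      and eq: "\<forall>x\<in>R. (\<Sum>i=0..n. a (n+1-i) * x ^ i * A (x ^ (n+1-i))) = 0" for a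
  proof -
    define m where "m = Max {i \<in> {1..n+1}. a i \<noteq> 0}"
    have "m \<in> {i \<in> {1..n+1}. a i \<noteq> 0}"
      unfolding m_def using nz by (intro Max_in) auto
    then have m: "m \<in> {1..n+1}" "a m \<noteq> 0"
      by auto
    have above: "a j = 0" if "j \<in> {1..n+1}" "m < j" for j
    proof (rule ccontr)
      assume "a j \<noteq> 0"
      with that(1) have "j \<le> m"
        unfolding m_def by (intro Max_ge) auto
      with that(2) show False by simp
    qed
    \<comment> \<open>For \<open>j < m\<close> the binomial coefficient vanishes, for
      \<open>j > m\<close> the constant \<open>a j\<close> does.\<close>
    have "of_nat (j choose m) * a j = (if j = m then a m else 0)" if "j \<in> {1..n+1}" for j
      using above[OF that] by (cases j m rule: linorder_cases) (auto simp: binomial_eq_0)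
    then have "(\<Sum>j=1..n+1. of_nat (j choose m) * a j) = (\<Sum>j=1..n+1. if j = m then a m else 0)"
      by (intro sum.cong) auto
    also have "\<dots> = a m"
      using m(1) by (subst sum.delta) auto
    \<comment> \<open>Since \<open>m \<ge> 1\<close>, \<open>Suc (m - 1)\<close> is
      \<open>m\<close>; the order obtained is \<open>m - 1\<close>, which is at most
      \<open>n\<close>.\<close>
    finally have "(ad x ^^ Suc (m - 1)) A 1 = 0" if "x \<in> R" for x
      using coeff[OF eq that m(1)] m by simp
    then have "A \<in> derivations (m - 1) R"
      by (rule funpow_ad_zero_imp_derivations[OF R A])
    moreover have "m - 1 \<le> n"
      using m(1) by auto
    ultimately show ?thesis
      using derivations_le_mono[OF R] by blast
  qed
  moreover have "(\<Sum>i=1..n+1. of_nat i * a i) = 0"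
    if "\<forall>x\<in>R. (\<Sum>i=0..n. a (n+1-i) * x ^ i * A (x ^ (n+1-i))) = 0" "x \<in> R" "A x \<noteq> 0" for a x
    \<comment> \<open>For \<open>i = 1\<close> the binomial coefficient is \<open>j\<close> and the
      commutator is \<open>A x - x * A 1 = A x\<close>, which is nonzero and cancels.\<close>
    using coeff[OF that(1,2), of 1] that(3) A(2) by (simp add: ad_def)
  ultimately show ?thesis
    by blast
qed

end
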